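(* (Strong concentration) Let $(\Omega,\mu)$ be a probability measure space. For any $H_0>0$ and any probability density $F$ on $\Omega$ with entropy $H\le H_0$ there exists a set $A\subset\Omega$ with $\mu(A)=V$ such that $$(1-c_{H_0})\,H\le\int_AF\ln F\,d\mu,$$ where $$c_{H_0}=\sup_{x\in[0,1],\;0<\eta\le H_0}\Big(\frac1\eta\,x\ln(1-x)+x\Big).$$
   Context: A probability density (distribution) on $\Omega$ is a function $F\ge0$ with $\int_\Omega F\,d\mu=1$. Its entropy is $H=\int_\Omega F\ln F\,d\mu$ and its volumetric factor is $V=e^{-H}$.
   Formalization: The probability space is assumed to be nonatomic; without this the claim fails, e.g. on two points of mass 1/2 with F = (3/2, 1/2), where no set has measure V. *)

theory Defs
  imports "HOL-Probability.Probability_Measure"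
begin

definition nonatomic :: "'a measure \<Rightarrow> bool" where
  "nonatomic M \<longleftrightarrow>
     (\<forall>A\<in>sets M. 0 < emeasure M A \<longrightarrow>
        (\<exists>B\<in>sets M. B \<subseteq> A \<and> 0 < emeasure M B \<and> emeasure M B < emeasure M A))"

definition prob_density :: "'a measure \<Rightarrow> ('a \<Rightarrow> real) \<Rightarrow> bool" where
  "prob_density M F \<longleftrightarrow>
     F \<in> borel_measurable M \<and> (\<forall>x\<in>space M. 0 \<le> F x) \<and>
     integrable M F \<and> (LINT x|M. F x) = 1"

(* The factor F x makes the integrand 0 where F x = 0, as in the usual convention 0 ln 0 = 0.
   The Bochner integral is 0 when the integrand is not integrable, so this is the
   entropy only if F ln F is integrable; otherwise the entropy is infinite, because
   t ln t \<ge> -1/e bounds the integrand from below. *)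
definition dens_entropy :: "'a measure \<Rightarrow> ('a \<Rightarrow> real) \<Rightarrow> real" where
  "dens_entropy M F = (LINT x|M. F x * ln (F x))"

definition vol_factor :: "'a measure \<Rightarrow> ('a \<Rightarrow> real) \<Rightarrow> real" where
  "vol_factor M F = exp (- dens_entropy M F)"

(* The real logarithm of the library has ln 0 = 0. With that value the point x = 1 would
   contribute 1 to the supremum below, and its value would always be 1. Here ln 0 = -\<infinity>. *)
definition ext_ln :: "real \<Rightarrow> ereal" where
  "ext_ln y = (if y \<le> 0 then - \<infinity> else ereal (ln y))"

definition conc_const :: "real \<Rightarrow> ereal" where
  "conc_const H0 =
     (SUP (x, \<eta>) \<in> {0..1} \<times> {0<..H0}. ereal (1 / \<eta>) * ereal x * ext_ln (1 - x) + ereal x)"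

end

theory Submission
  imports Defs
begin

text \<open>
  The entropy \<open>H\<close> is nonnegative, and if \<open>H = 0\<close> then the whole space serves. So let \<open>H > 0\<close>, that
  is \<open>0 < V < 1\<close>, and take for \<open>A\<close> the part of the space where the density is largest. Since the measure is
  nonatomic, there are a threshold \<open>t\<close> and a measurable set \<open>A\<close> of measure exactly
  \<open>V = exp (- H)\<close> with \<open>{F > t} \<subseteq> A \<subseteq> {F \<ge> t}\<close> (lemma \<open>superlevel_set_of_measure\<close>; the
  level set \<open>{F = t}\<close> may have positive measure, and the intermediate value theorem of Sierpinski,
  \<open>nonatomic_intermediate_measure\<close>, cuts it at the right place).

  Let \<open>x\<close> be the mass that \<open>F\<close> puts outside \<open>A\<close>. As \<open>F \<ge> t\<close> on \<open>A\<close>, the mass on \<open>A\<close> gives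
  \<open>t V \<le> 1 - x\<close>, that is \<open>ln t \<le> ln (1 - x) + H\<close>. As \<open>F \<le> t\<close> outside \<open>A\<close>, the entropy lost there
  is at most \<open>x ln t \<le> x ln (1 - x) + x H\<close>. This is \<open>H\<close> times the expression in the definition of
  the constant, taken at this \<open>x\<close> and at \<open>\<eta> = H\<close>.
\<close>

section \<open>Intermediate values of nonatomic measures\<close>

text \<open>
  Splitting a set of positive measure into two parts of positive measure and keeping the
  smaller one at least halves the measure; repeat.
\<close>

lemma (in finite_measure) nonatomic_small_subset:
  assumes "nonatomic M" and "A \<in> sets M" and "0 < measure M A" and "0 < e"
  shows "\<exists>B\<in>sets M. B \<subseteq> A \<and> 0 < measure M B \<and> measure M B \<le> e"
proof -
  have halve: "\<exists>C\<in>sets M. C \<subseteq> B \<and> 0 < measure M C \<and> measure M C \<le> measure M B / 2"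
    if B: "B \<in> sets M" "0 < measure M B" for B
  proof -
    have "0 < emeasure M B"
      using B by (simp add: emeasure_eq_measure)
    then obtain C where C: "C \<in> sets M" "C \<subseteq> B" "0 < emeasure M C" "emeasure M C < emeasure M B"
      using \<open>nonatomic M\<close> B unfolding nonatomic_def by blast
    have pos: "0 < measure M C" "measure M C < measure M B"
      using C by (auto simp: emeasure_eq_measure ennreal_less_iff)
    have diff: "measure M (B - C) = measure M B - measure M C"
      using B C by (intro finite_measure_Diff) auto
    show ?thesis
    proof (cases "measure M C \<le> measure M B / 2")
      case True
      with C pos show ?thesis by blast
    next
      case False
      with B C pos diff show ?thesis by (intro bexI[of _ "B - C"]) auto
    qed
  qed
  have iter: "\<exists>B\<in>sets M. B \<subseteq> A \<and> 0 < measure M B \<and> measure M B \<le> measure M A / 2 ^ n" for n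
  proof (induction n)
    case 0
    with assms show ?case by auto
  next
    case (Suc n)
    then obtain B where B: "B \<in> sets M" "B \<subseteq> A" "0 < measure M B" "measure M B \<le> measure M A / 2 ^ n"
      by blast
    with halve obtain C where "C \<in> sets M" "C \<subseteq> B" "0 < measure M C" "measure M C \<le> measure M B / 2"
      by blast
    moreover from calculation B(4) have "measure M C \<le> measure M A / 2 ^ n / 2"
      by (meson divide_right_mono order_trans zero_le_numeral)
    ultimately show ?case
      using B by (intro bexI[of _ C]) (auto simp: mult.commute)
  qed
  obtain n where "measure M A / e < 2 ^ n"
    using real_arch_pow[of 2 "measure M A / e"] by auto
  with \<open>0 < e\<close> have "measure M A / 2 ^ n < e"
    by (simp add: field_simps)
  with iter[of n] show ?thesis by (meson less_imp_le order_trans)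
qed

text \<open>
  Sierpinski's theorem, by greedy exhaustion: repeatedly add to the set built so far a piece whose
  measure is at least half of the largest measure that still fits below \<open>v\<close>. The measures of the
  pieces tend to zero. If the union of all pieces fell short of \<open>v\<close>, a small set of positive
  measure could be added to it, and the greedy choice would have taken pieces of at least half that
  measure at every stage.
\<close>

lemma (in finite_measure) nonatomic_intermediate_measure:
  assumes "nonatomic M" and B: "B \<in> sets M" and v: "0 \<le> v" "v \<le> measure M B"
  shows "\<exists>A\<in>sets M. A \<subseteq> B \<and> measure M A = v"
proof -
  let ?P = "\<lambda>A. A \<in> sets M \<and> A \<subseteq> B \<and> measure M A \<le> v"
  let ?Q = "\<lambda>A A'. A \<subseteq> A' \<and>
    (\<forall>E\<in>sets M. E \<subseteq> B - A \<longrightarrow> measure M E \<le> v - measure M A \<longrightarrow>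
       measure M E \<le> 2 * (measure M A' - measure M A))"
  have "\<exists>f. \<forall>n. ?P (f n) \<and> ?Q (f n) (f (Suc n))"
  proof (rule dependent_nat_choice)
    show "\<exists>A. ?P A"
      using v by (intro exI[of _ "{}"]) auto
  next
    fix A
    assume A: "?P A"
    define X where "X = measure M ` {E \<in> sets M. E \<subseteq> B - A \<and> measure M E \<le> v - measure M A}"
    have bdd: "bdd_above X"
      unfolding X_def by (rule bdd_aboveI[of _ "v - measure M A"]) auto
    have ne: "X \<noteq> {}"
      using A unfolding X_def by (auto intro!: exI[of _ "{}"])
    have upper: "measure M E \<le> Sup X"
      if "E \<in> sets M" "E \<subseteq> B - A" "measure M E \<le> v - measure M A" for E
      using bdd that by (intro cSup_upper) (auto simp: X_def)
    \<comment> \<open>The greedy choice takes a piece of measure more than \<open>Sup X / 2\<close>. If the supremum is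
      zero, nothing of positive measure fits, and the set stays as it is.\<close>
    show "\<exists>A'. ?P A' \<and> ?Q A A'"
    proof (cases "Sup X \<le> 0")
      case True
      with A upper show ?thesis by (intro exI[of _ A]) force
    next
      case False
      then obtain y where "y \<in> X" "Sup X / 2 < y"
        using less_cSupD[OF ne, of "Sup X / 2"] by auto
      then obtain E where E: "E \<in> sets M" "E \<subseteq> B - A" "measure M E \<le> v - measure M A"
        and big: "Sup X / 2 < measure M E"
        by (auto simp: X_def)
      have "measure M (A \<union> E) = measure M A + measure M E"
        using A E by (intro finite_measure_Union) auto
      moreover have "measure M E' \<le> 2 * measure M E"
        if "E' \<in> sets M" "E' \<subseteq> B - A" "measure M E' \<le> v - measure M A" for E'
        using upper[OF that] big by linarith
      ultimately show ?thesis
        using A E by (intro exI[of _ "A \<union> E"]) auto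
    qed
  qed
  then obtain f where f: "\<forall>n. ?P (f n) \<and> ?Q (f n) (f (Suc n))" ..
  have P: "?P (f n)" and Q: "?Q (f n) (f (Suc n))" for n
    using conjunct1[OF spec[OF f, of n]] conjunct2[OF spec[OF f, of n]] by -
  let ?A = "\<Union>n. f n"
  have A: "?A \<in> sets M" "?A \<subseteq> B"
    using P by auto
  have "incseq f"
    using Q by (intro incseq_SucI) blast
  with P have lim: "(\<lambda>n. measure M (f n)) \<longlonglongrightarrow> measure M ?A"
    by (intro finite_Lim_measure_incseq) auto
  have le: "measure M ?A \<le> v"
    using P by (intro LIMSEQ_le_const2[OF lim]) auto
  have "measure M ?A = v"
  proof (rule ccontr)
    assume "measure M ?A \<noteq> v"
    with le have less: "measure M ?A < v" by simp
    have "measure M (B - ?A) = measure M B - measure M ?A"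
      using A B by (intro finite_measure_Diff) auto
    with less v have "0 < measure M (B - ?A)" by simp
    then obtain E where E: "E \<in> sets M" "E \<subseteq> B - ?A" "0 < measure M E" "measure M E \<le> v - measure M ?A"
      using nonatomic_small_subset[OF \<open>nonatomic M\<close>, of "B - ?A" "v - measure M ?A"] A B less
      by auto
    have stage: "measure M E \<le> 2 * (measure M (f (Suc n)) - measure M (f n))" for n
    proof -
      have "measure M (f n) \<le> measure M ?A"
        using A by (intro finite_measure_mono) auto
      with E have "E \<subseteq> B - f n" "measure M E \<le> v - measure M (f n)" by auto
      with E Q[of n] show ?thesis by blast
    qed
    have "(\<lambda>n. 2 * (measure M (f (Suc n)) - measure M (f n))) \<longlonglongrightarrow> 2 * (measure M ?A - measure M ?A)"
      by (intro tendsto_intros lim LIMSEQ_Suc[OF lim])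
    with stage have "measure M E \<le> 2 * (measure M ?A - measure M ?A)"
      by (intro LIMSEQ_le_const) auto
    with E show False by simp
  qed
  with A show ?thesis by blast
qed

section \<open>Superlevel sets of prescribed measure\<close>

text \<open>
  The threshold is the quantile \<open>t = inf {s. measure {f > s} \<le> v}\<close>. Continuity of the measure from
  below and from above gives \<open>measure {f > t} \<le> v \<le> measure {f \<ge> t}\<close>. The strict bounds
  on \<open>v\<close> are what makes \<open>t\<close> finite.
\<close>

lemma (in finite_measure) superlevel_set_of_measure:
  fixes f :: "'a \<Rightarrow> real"
  assumes "nonatomic M" and f [measurable]: "f \<in> borel_measurable M"
    and v: "0 < v" "v < measure M (space M)"
  obtains A t where "A \<in> sets M" and "measure M A = v"
    and "\<And>x. x \<in> A \<Longrightarrow> t \<le> f x" and "\<And>x. x \<in> space M - A \<Longrightarrow> f x \<le> t"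
proof -
  define U where "U s = {x \<in> space M. s < f x}" for s
  have U [measurable]: "U s \<in> sets M" for s
    unfolding U_def by measurable
  have U_sub: "U s \<subseteq> U r" if "r \<le> s" for r s
    using that by (auto simp: U_def)
  then have U_anti: "measure M (U s) \<le> measure M (U r)" if "r \<le> s" for r s
    using that by (intro finite_measure_mono) auto
  define S where "S = {s. measure M (U s) \<le> v}"

  \<comment> \<open>Since \<open>f\<close> is finite, \<open>measure (U s)\<close> tends to zero as \<open>s\<close> grows and to the full measure
    as \<open>s\<close> decreases, so the infimum of \<open>S\<close> is a real number.\<close>
  have "(\<lambda>n. measure M (U (real n))) \<longlonglongrightarrow> measure M (\<Inter>n. U (real n))"
    by (intro finite_Lim_measure_decseq decseq_SucI U_sub) auto
  moreover have "(\<Inter>n. U (real n)) = {}"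
  proof -
    have "\<exists>n. \<not> real n < f x" for x
      using reals_Archimedean2[of "f x"] less_asym by blast
    then show ?thesis by (auto simp: U_def)
  qed
  ultimately have "(\<lambda>n. measure M (U (real n))) \<longlonglongrightarrow> 0"
    by simp
  then have "\<forall>\<^sub>F n in sequentially. measure M (U (real n)) < v"
    using v by (intro order_tendstoD) auto
  then obtain n where "measure M (U (real n)) < v"
    by (auto simp: eventually_sequentially)
  then have ne: "S \<noteq> {}"
    by (auto simp: S_def intro!: exI[of _ "real n"])

  have "(\<lambda>n. measure M (U (- real n))) \<longlonglongrightarrow> measure M (\<Union>n. U (- real n))"
    by (intro finite_Lim_measure_incseq incseq_SucI U_sub) auto
  moreover have "(\<Union>n. U (- real n)) = space M"
  proof -
    have "\<exists>n. - real n < f x" for x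
      using reals_Archimedean2[of "- f x"] by (auto simp: minus_less_iff)
    then show ?thesis by (auto simp: U_def)
  qed
  ultimately have "(\<lambda>n. measure M (U (- real n))) \<longlonglongrightarrow> measure M (space M)"
    by simp
  then have "\<forall>\<^sub>F n in sequentially. v < measure M (U (- real n))"
    using v by (intro order_tendstoD) auto
  then obtain m where m: "v < measure M (U (- real m))"
    by (auto simp: eventually_sequentially)
  have bdd: "bdd_below S"
  proof (rule bdd_belowI[of _ "- real m"])
    fix s assume "s \<in> S"
    with m U_anti[of s "- real m"] show "- real m \<le> s"
      by (cases "s \<le> - real m") (auto simp: S_def)
  qed

  define t where "t = Inf S"
  have above: "measure M (U s) \<le> v" if "t < s" for s
  proof -
    from that obtain r where "r \<in> S" "r < s"
      unfolding t_def using cInf_lessD[OF ne] by blast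
    with U_anti[of r s] show ?thesis by (auto simp: S_def)
  qed
  have below: "v < measure M (U s)" if "s < t" for s
    using that cInf_lower[OF _ bdd, of s] unfolding t_def S_def by fastforce

  \<comment> \<open>\<open>above\<close> says nothing about \<open>s = t\<close> itself; \<open>{f > t}\<close> is reached from thresholds above \<open>t\<close>,
    and \<open>{f \<ge> t}\<close> from thresholds less than \<open>t\<close>.\<close>
  have "(\<lambda>n. measure M (U (t + 1 / real (Suc n)))) \<longlonglongrightarrow> measure M (\<Union>n. U (t + 1 / real (Suc n)))"
    by (intro finite_Lim_measure_incseq incseq_SucI U_sub add_left_mono divide_left_mono) auto
  moreover have "(\<Union>n. U (t + 1 / real (Suc n))) = U t"
  proof -
    have "t < y \<longleftrightarrow> (\<exists>n. t + 1 / real (Suc n) < y)" for y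
    proof
      assume "t < y"
      then have "0 < y - t" by simp
      from reals_Archimedean[OF this] obtain n where "1 / real (Suc n) < y - t"
        by (auto simp: inverse_eq_divide)
      then show "\<exists>n. t + 1 / real (Suc n) < y" by (intro exI[of _ n]) simp
    next
      assume "\<exists>n. t + 1 / real (Suc n) < y"
      then obtain n where "t + 1 / real (Suc n) < y" ..
      moreover have "0 < 1 / real (Suc n)" by simp
      ultimately show "t < y" by linarith
    qed
    then show ?thesis by (auto simp: U_def)
  qed
  ultimately have "(\<lambda>n. measure M (U (t + 1 / real (Suc n)))) \<longlonglongrightarrow> measure M (U t)"
    by simp
  then have Ut: "measure M (U t) \<le> v"
    by (rule LIMSEQ_le_const2) (use above in auto)

  define W where "W = {x \<in> space M. t \<le> f x}"
  have W [measurable]: "W \<in> sets M"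
    unfolding W_def by measurable
  have "(\<lambda>n. measure M (U (t - 1 / real (Suc n)))) \<longlonglongrightarrow> measure M (\<Inter>n. U (t - 1 / real (Suc n)))"
    by (intro finite_Lim_measure_decseq decseq_SucI U_sub diff_left_mono divide_left_mono) auto
  moreover have "(\<Inter>n. U (t - 1 / real (Suc n))) = W"
  proof -
    have "t \<le> y \<longleftrightarrow> (\<forall>n. t - 1 / real (Suc n) < y)" for y
    proof
      assume "t \<le> y"
      show "\<forall>n. t - 1 / real (Suc n) < y"
      proof
        fix n
        have "0 < 1 / real (Suc n)" by simp
        with \<open>t \<le> y\<close> show "t - 1 / real (Suc n) < y" by linarith
      qed
    next
      assume all: "\<forall>n. t - 1 / real (Suc n) < y"
      show "t \<le> y"
      proof (rule ccontr)
        assume "\<not> t \<le> y"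
        then have "0 < t - y" by simp
        from reals_Archimedean[OF this] obtain n where "1 / real (Suc n) < t - y"
          by (auto simp: inverse_eq_divide)
        with all[rule_format, of n] show False by linarith
      qed
    qed
    then show ?thesis by (auto simp: U_def W_def)
  qed
  ultimately have "(\<lambda>n. measure M (U (t - 1 / real (Suc n)))) \<longlonglongrightarrow> measure M W"
    by simp
  moreover have "v \<le> measure M (U (t - 1 / real (Suc n)))" for n
    by (intro less_imp_le below) simp
  ultimately have vW: "v \<le> measure M W"
    by (intro LIMSEQ_le_const) auto

  have sub: "U t \<subseteq> W"
    by (auto simp: U_def W_def)
  then have "measure M (W - U t) = measure M W - measure M (U t)"
    by (intro finite_measure_Diff) auto
  then obtain E where E: "E \<in> sets M" "E \<subseteq> W - U t" "measure M E = v - measure M (U t)"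
    using nonatomic_intermediate_measure[OF \<open>nonatomic M\<close>, of "W - U t" "v - measure M (U t)"] Ut vW
    by auto
  show thesis
  proof
    show "U t \<union> E \<in> sets M" using E by auto
    have "measure M (U t \<union> E) = measure M (U t) + measure M E"
      using E by (intro finite_measure_Union) auto
    with E show "measure M (U t \<union> E) = v" by simp
    show "t \<le> f x" if "x \<in> U t \<union> E" for x
      using that E sub by (auto simp: W_def)
    show "f x \<le> t" if "x \<in> space M - (U t \<union> E)" for x
      using that by (auto simp: U_def)
  qed
qed

section \<open>Entropy inside and outside a superlevel set\<close>

text \<open>Integrate \<open>F ln F \<ge> F - 1\<close>; the right-hand side has integral zero.\<close>

lemma (in prob_space) dens_entropy_nonneg:
  assumes F: "prob_density M F" and int: "integrable M (\<lambda>x. F x * ln (F x))"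
  shows "0 \<le> dens_entropy M F"
proof -
  have pointwise: "y - 1 \<le> y * ln y" if "0 \<le> y" for y :: real
  proof (cases "y = 0")
    case False
    with that have "0 < y" by simp
    with ln_le_minus_one[of "1 / y"] have "1 - 1 / y \<le> ln y"
      by (simp add: ln_div)
    with \<open>0 < y\<close> have "y * (1 - 1 / y) \<le> y * ln y"
      by (intro mult_left_mono) auto
    with \<open>0 < y\<close> show ?thesis by (simp add: right_diff_distrib)
  qed simp
  have "(LINT x|M. F x - 1) \<le> (LINT x|M. F x * ln (F x))"
    using F int pointwise by (intro integral_mono) (auto simp: prob_density_def)
  moreover have "(LINT x|M. F x - 1) = 0"
    using F by (simp add: prob_density_def prob_space)
  ultimately show ?thesis by (simp add: dens_entropy_def)
qed

lemma conc_const_ge: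
  assumes "0 \<le> x" and "x < 1" and "0 < \<eta>" and "\<eta> \<le> H0"
  shows "ereal (x * ln (1 - x) / \<eta> + x) \<le> conc_const H0"
  unfolding conc_const_def
  by (rule SUP_upper2[of "(x, \<eta>)"]) (use assms in \<open>auto simp: ext_ln_def\<close>)

text \<open>
  The entropy of \<open>F\<close> outside the set where \<open>F\<close> is largest is at most \<open>x ln t\<close>, and \<open>t\<close> is at most
  the average of \<open>F\<close> over that set.
\<close>

lemma (in prob_space) entropy_outside_superlevel_set:
  assumes F: "prob_density M F" and int: "integrable M (\<lambda>x. F x * ln (F x))"
    and A [measurable]: "A \<in> sets M" and V: "measure M A = vol_factor M F" "measure M A < 1"
    and ge: "\<And>x. x \<in> A \<Longrightarrow> t \<le> F x" and le: "\<And>x. x \<in> space M - A \<Longrightarrow> F x \<le> t"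
  defines "x \<equiv> (LINT w:(space M - A)|M. F w)"
  shows "0 \<le> x" and "x < 1"
    and "(LINT w:(space M - A)|M. F w * ln (F w)) \<le> x * ln (1 - x) + x * dens_entropy M F"
proof -
  let ?B = "space M - A" and ?H = "dens_entropy M F"
  have nonneg: "\<And>w. w \<in> space M \<Longrightarrow> 0 \<le> F w" and intF: "integrable M F" and one: "(LINT w|M. F w) = 1"
    using F by (auto simp: prob_density_def)
  have setA: "set_integrable M A F" and setB: "set_integrable M ?B F"
    and setBln: "set_integrable M ?B (\<lambda>w. F w * ln (F w))"
    unfolding set_integrable_def by (intro integrable_mult_indicator intF int sets.Diff sets.top A)+
  show x0: "0 \<le> x"
    unfolding x_def set_lebesgue_integral_def
    by (intro integral_nonneg_AE AE_I2) (auto simp: nonneg indicator_def)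
  have "(LINT w:(A \<union> ?B)|M. F w) = (LINT w:A|M. F w) + x"
    unfolding x_def by (intro set_integral_Un setA setB) auto
  moreover have "A \<union> ?B = space M"
    using sets.sets_into_space[OF A] by auto
  moreover have "(LINT w:space M|M. F w) = 1"
    using one by (simp add: set_integral_space intF)
  ultimately have massA: "(LINT w:A|M. F w) = 1 - x"
    by simp
  have "(LINT w:A|M. t) \<le> (LINT w:A|M. F w)"
  proof (rule set_integral_mono[OF _ setA ge])
    show "set_integrable M A (\<lambda>_. t)"
      unfolding set_integrable_def by (intro integrable_mult_indicator integrable_const A)
  qed
  then have avg: "t * exp (- ?H) \<le> 1 - x"
    using massA V by (simp add: set_lebesgue_integral_def vol_factor_def mult.commute)
  have "?B \<noteq> {}"
  proof
    assume "?B = {}"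
    with sets.sets_into_space[OF A] have "A = space M" by auto
    with V prob_space show False by simp
  qed
  with le nonneg have "0 \<le> t" by force
  have "x < 1 \<and> (LINT w:?B|M. F w * ln (F w)) \<le> x * ln (1 - x) + x * ?H"
  proof (cases "t = 0")
    case True
    \<comment> \<open>Here \<open>F\<close> vanishes outside \<open>A\<close>; the inequality between \<open>ln t\<close> and \<open>ln (1 - x) + H\<close>
      is available only for \<open>t > 0\<close>.\<close>
    then have zero: "F w = 0" if "w \<in> ?B" for w
      using that le[of w] nonneg[of w] by auto
    then have "x = 0"
      unfolding x_def by (subst set_lebesgue_integral_cong[where g = "\<lambda>_. 0"]) auto
    moreover have "(LINT w:?B|M. F w * ln (F w)) = 0"
      using zero by (subst set_lebesgue_integral_cong[where g = "\<lambda>_. 0"]) auto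
    ultimately show ?thesis by simp
  next
    case False
    with \<open>0 \<le> t\<close> have t: "0 < t" by simp
    then have "0 < t * exp (- ?H)" by simp
    with avg have x1: "x < 1" by linarith
    have "F w * ln (F w) \<le> F w * ln t" if "w \<in> ?B" for w
    proof (cases "F w = 0")
      case False
      with that nonneg[of w] have "0 < F w" by auto
      with le[OF that] show ?thesis by (intro mult_left_mono) auto
    qed simp
    then have "(LINT w:?B|M. F w * ln (F w)) \<le> (LINT w:?B|M. F w * ln t)"
      using setB setBln by (intro set_integral_mono) auto
    also have "\<dots> = x * ln t"
      unfolding x_def by simp
    also have "\<dots> \<le> x * (ln (1 - x) + ?H)"
    proof (intro mult_left_mono x0)
      have "ln (t * exp (- ?H)) \<le> ln (1 - x)"
        using avg t x1 by simp
      then show "ln t \<le> ln (1 - x) + ?H"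
        using t by (simp add: ln_mult)
    qed
    finally show ?thesis using x1 by (simp add: algebra_simps)
  qed
  then show "x < 1" and "(LINT w:?B|M. F w * ln (F w)) \<le> x * ln (1 - x) + x * ?H"
    by auto
qed

theorem lemma3p5:
  fixes M :: "'a measure" and F :: "'a \<Rightarrow> real" and H0 :: real
  assumes "prob_space M" and "nonatomic M"
    and "0 < H0"
    and "prob_density M F"
    and "integrable M (\<lambda>x. F x * ln (F x))"
    and "dens_entropy M F \<le> H0"
  shows "\<exists>A\<in>sets M. measure M A = vol_factor M F \<and>
           (1 - conc_const H0) * ereal (dens_entropy M F)
             \<le> ereal (LINT x:A|M. F x * ln (F x))"
proof -
  interpret prob_space M by fact
  let ?H = "dens_entropy M F" and ?g = "\<lambda>x. F x * ln (F x)"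
  have space: "(LINT x:space M|M. ?g x) = ?H"
    using assms(5) by (simp add: set_integral_space dens_entropy_def)
  show ?thesis
  proof (cases "?H = 0")
    case True
    \<comment> \<open>Then \<open>V = 1\<close>, so the whole space serves; \<open>\<eta> = H\<close> would not be admissible.\<close>
    then show ?thesis
      using space by (intro bexI[of _ "space M"]) (auto simp: vol_factor_def prob_space zero_ereal_def[symmetric])
  next
    case False
    with dens_entropy_nonneg[OF assms(4,5)] have H: "0 < ?H" by simp
    then have V: "0 < vol_factor M F" "vol_factor M F < 1"
      by (auto simp: vol_factor_def)
    have "F \<in> borel_measurable M"
      using assms(4) by (simp add: prob_density_def)
    with V obtain A t where A: "A \<in> sets M" "measure M A = vol_factor M F"
      and ge: "\<And>x. x \<in> A \<Longrightarrow> t \<le> F x" and le: "\<And>x. x \<in> space M - A \<Longrightarrow> F x \<le> t"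
      using superlevel_set_of_measure[OF \<open>nonatomic M\<close>, of F "vol_factor M F"]
      by (auto simp: prob_space)
    define x where "x = (LINT w:(space M - A)|M. F w)"
    let ?r = "x * ln (1 - x) / ?H + x"
    have x: "0 \<le> x" "x < 1" and outside: "(LINT w:(space M - A)|M. ?g w) \<le> x * ln (1 - x) + x * ?H"
      using entropy_outside_superlevel_set[OF assms(4,5) A _ ge le] A V unfolding x_def by auto
    have "(LINT w:(A \<union> (space M - A))|M. ?g w) = (LINT w:A|M. ?g w) + (LINT w:(space M - A)|M. ?g w)"
    proof (rule set_integral_Un)
      show "set_integrable M A ?g" and "set_integrable M (space M - A) ?g"
        unfolding set_integrable_def by (intro integrable_mult_indicator assms(5) sets.Diff sets.top A)+
    qed auto
    moreover have "A \<union> (space M - A) = space M"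
      using sets.sets_into_space[OF A(1)] by auto
    ultimately have "?H - (x * ln (1 - x) + x * ?H) \<le> (LINT w:A|M. ?g w)"
      using outside space by simp
    moreover have "(1 - ?r) * ?H = ?H - (x * ln (1 - x) + x * ?H)"
      using H by (simp add: left_diff_distrib distrib_right)
    ultimately have "(1 - ?r) * ?H \<le> (LINT w:A|M. ?g w)"
      by simp
    moreover have "(1 - conc_const H0) * ereal ?H \<le> ereal (1 - ?r) * ereal ?H"
    proof (rule ereal_mult_right_mono)
      have "1 - conc_const H0 \<le> 1 - ereal ?r"
        using conc_const_ge[OF x H assms(6)] by (rule ereal_minus_mono[OF order_refl])
      then show "1 - conc_const H0 \<le> ereal (1 - ?r)"
        by (simp add: one_ereal_def)
    qed (use H in simp)
    ultimately show ?thesis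
      using A by (intro bexI[of _ A]) (auto intro: order_trans)
  qed
qed

end
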